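(* Let $k,n\in\mathbb{N}$, let $G_k:=\langle\mathrm{Alt}(\mathbb{Z}),t^k\rangle\le\mathrm{Sym}(\mathbb{Z})$, and let $g_1,\ldots,g_n\in G_k\setminus\mathrm{Alt}(\mathbb{Z})$. Then there exists an element $h$ in the conjugacy class $[t^k]$ of $t^k$ in $G_k$ such that $\langle g_1,h\rangle=\cdots=\langle g_n,h\rangle=G_k$.
   Context: $\mathbb{N}=\{1,2,3,\ldots\}$. $\mathrm{Sym}(\mathbb{Z})$ is the group of all bijections of $\mathbb{Z}$, acting on the right (so products are composed left to right). $\mathrm{FSym}(\mathbb{Z})$ is the subgroup of bijections moving only finitely many points, and $\mathrm{Alt}(\mathbb{Z})\le\mathrm{FSym}(\mathbb{Z})$ is the subgroup of even permutations. $t\in\mathrm{Sym}(\mathbb{Z})$ is the translation $z\mapsto z+1$. *)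

theory Defs
  imports "HOL-Algebra.Algebra" "HOL-Combinatorics.Permutations"
begin

text \<open>
  Permutations act on the right, so the product of f and g is first f, then g.
\<close>

definition SymZ :: "(int \<Rightarrow> int) monoid" where
  "SymZ = \<lparr>carrier = {f. bij f}, monoid.mult = (\<lambda>f g. g \<circ> f), one = id\<rparr>"

definition FSymZ :: "(int \<Rightarrow> int) set" where
  "FSymZ = {f \<in> carrier SymZ. finite {z. f z \<noteq> z}}"

definition AltZ :: "(int \<Rightarrow> int) set" where
  "AltZ = {f \<in> FSymZ. evenperm f}"

definition transl :: "int \<Rightarrow> int" where
  "transl = (\<lambda>z. z + 1)"

definition Gk :: "nat \<Rightarrow> (int \<Rightarrow> int) set" where
  "Gk k = generate SymZ (AltZ \<union> {transl [^]\<^bsub>SymZ\<^esub> k})"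

definition conjugacy_class :: "('a, 'b) monoid_scheme \<Rightarrow> 'a \<Rightarrow> 'a set" where
  "conjugacy_class G a = {inv\<^bsub>G\<^esub> x \<otimes>\<^bsub>G\<^esub> a \<otimes>\<^bsub>G\<^esub> x | x. x \<in> carrier G}"

lemma group_SymZ: "group SymZ"
proof (rule groupI)
  fix f assume "f \<in> carrier SymZ"
  then have f: "bij f" by (simp add: SymZ_def)
  then have "f \<circ> inv_into UNIV f = id"
    using surj_iff bij_is_surj by blast
  with f show "\<exists>g\<in>carrier SymZ. g \<otimes>\<^bsub>SymZ\<^esub> f = \<one>\<^bsub>SymZ\<^esub>"
    by (intro bexI[of _ "inv_into UNIV f"]) (auto simp: SymZ_def bij_imp_bij_inv)
qed (auto simp: SymZ_def bij_comp comp_assoc)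

lemma transl_in_SymZ: "transl \<in> carrier SymZ"
  unfolding SymZ_def transl_def
  by (auto intro!: bijI injI surjI[of _ "\<lambda>z. z - 1"])

lemma transl_pow: "transl [^]\<^bsub>SymZ\<^esub> (k::nat) = (\<lambda>z. z + int k)"
  by (induction k) (auto simp: SymZ_def transl_def nat_pow_def)

lemma subgroup_Gk: "subgroup (Gk k) SymZ"
proof -
  interpret group SymZ by (rule group_SymZ)
  show ?thesis
    unfolding Gk_def
    by (rule generate_is_subgroup) (auto simp: AltZ_def FSymZ_def transl_in_SymZ)
qed

end

theory Submission
  imports Defs
begin

text \<open>
  Every \<open>g\<close> in \<open>Gk k\<close> is an even finitary permutation followed by a translation by a multiple
  \<open>k * m\<close> of \<open>k\<close>; outside \<open>AltZ\<close> we have \<open>m \<noteq> 0\<close>, so far from the origin \<open>g\<close> or its inverse is the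
  translation by \<open>k * d\<close> for some \<open>d \<ge> 1\<close> (\<open>eventual_shift_of_Gk\<close>). Finitely many such elements share
  a threshold beyond which all of them behave in this way.

  The mate \<open>h\<close> is the conjugate of the translation by \<open>k\<close> under an \<open>\<alpha>\<close> that rotates two blocks of
  \<open>k + 1\<close> consecutive integers, \<open>{A..A + k}\<close> far to the right and \<open>{B..B + k}\<close> far to the left, both
  beyond the threshold. Both cycles have the same parity, so \<open>\<alpha>\<close> is even and lies in \<open>Gk k\<close>.
  Undoing the conjugation, the task is to show that the translation \<open>z \<mapsto> z + k\<close> and the conjugate
  \<open>\<alpha>\<inverse> \<circ> g \<circ> \<alpha>\<close> generate a group \<open>K\<close> containing \<open>AltZ\<close>. One \<open>\<alpha>\<close> serves all
  given elements at once, because its choice depends on them only through the threshold.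

  Call two points linked if they are equal or lie on a common three-cycle of \<open>K\<close>. This is a
  \<open>K\<close>-invariant equivalence relation, and if all points are linked then \<open>K\<close> contains every three-cycle
  and hence every even finitary permutation (\<open>even_permutation_mem\<close>). That all points are linked
  (\<open>all_linked_of_eventual_shift\<close>) is seen in two steps.

  First, a three-cycle. The element \<open>f\<close> obtained from \<open>\<alpha>\<inverse> \<circ> g \<circ> \<alpha>\<close> by cancelling the
  translation by \<open>k * d\<close> is finitary, and whatever \<open>g\<close> does near the origin, the least point
  \<open>B - k * d\<close> and the greatest point \<open>A + k\<close> of its support are produced by \<open>\<alpha>\<close>. Their distance is a
  multiple of \<open>k\<close>, so \<open>K\<close> contains the translate of \<open>f\<close> whose least moved point is \<open>A + k\<close>. The two supports
  meet in that point only, so the commutator is a three-cycle; the left block is arranged so that it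
  links \<open>A + k\<close> with \<open>A + 2 * k\<close>. By translation, all multiples of \<open>k\<close> are linked.

  Second, the right block connects the residue classes modulo \<open>k\<close>: the point \<open>A + i\<close> of the block is
  sent by \<open>\<alpha>\<inverse> \<circ> g \<circ> \<alpha>\<close> into the class of \<open>i + 1\<close>, whereas points of the class of \<open>i\<close> to the right of the
  block stay in their class.
\<close>

section \<open>Groups of permutations that contain three-cycles\<close>

locale perm_group =
  fixes K :: "('a \<Rightarrow> 'a) set"
  assumes bij_mem: "u \<in> K \<Longrightarrow> bij u"
    and id_mem: "id \<in> K"
    and comp_mem: "u \<in> K \<Longrightarrow> v \<in> K \<Longrightarrow> u \<circ> v \<in> K"
    and inv_mem: "u \<in> K \<Longrightarrow> inv' u \<in> K"

text \<open>
  For distinct arguments this is the cycle \<open>a \<mapsto> b \<mapsto> c \<mapsto> a\<close>; the definition as a product of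
  transpositions makes it a bijection for all arguments.
\<close>

definition three_cycle :: "'a \<Rightarrow> 'a \<Rightarrow> 'a \<Rightarrow> 'a \<Rightarrow> 'a" where
  "three_cycle a b c = transpose a b \<circ> transpose b c"

lemma bij_three_cycle: "bij (three_cycle a b c)"
  by (simp add: three_cycle_def bij_comp)

lemma three_cycle_apply:
  assumes "a \<noteq> b" "b \<noteq> c" "a \<noteq> c"
  shows "three_cycle a b c z = (if z = a then b else if z = b then c else if z = c then a else z)"
  using assms by (auto simp: three_cycle_def transpose_def)

lemma three_cycle_rotate:
  assumes "a \<noteq> b" "b \<noteq> c" "a \<noteq> c"
  shows "three_cycle a b c = three_cycle b c a"
  using assms by (auto simp: fun_eq_iff three_cycle_apply)

lemma inv_three_cycle: "inv' (three_cycle a b c) = three_cycle c b a"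
  by (simp add: three_cycle_def o_inv_distrib transpose_commute)

lemma conj_three_cycle:
  assumes "bij u"
  shows "u \<circ> three_cycle a b c \<circ> inv' u = three_cycle (u a) (u b) (u c)"
proof -
  have tr: "u \<circ> transpose x y = transpose (u x) (u y) \<circ> u" for x y
    using assms by (auto simp: fun_eq_iff transpose_def bij_def inj_eq)
  have "u \<circ> three_cycle a b c = three_cycle (u a) (u b) (u c) \<circ> u"
    unfolding three_cycle_def by (metis comp_assoc tr)
  then show ?thesis
    using assms by (metis bij_is_surj comp_assoc comp_id surj_iff)
qed

text \<open>
  Conjugating \<open>F'\<close> by \<open>F\<close> changes its cycle structure only by replacing \<open>y\<close> with \<open>F y\<close>, because \<open>F\<close>
  fixes every other point that \<open>F'\<close> moves. Composing with the inverse of \<open>F'\<close> therefore cancels all but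
  three points.
\<close>

lemma commutator_three_cycle:
  assumes "bij F" "bij F'"
    and y: "F y \<noteq> y" "F' y \<noteq> y"
    and meet: "\<And>z. z \<noteq> y \<Longrightarrow> F z = z \<or> F' z = z"
  shows "F \<circ> F' \<circ> inv' F \<circ> inv' F' = three_cycle y (F y) (F' y)"
proof -
  have inj: "F a = F b \<longleftrightarrow> a = b" "F' a = F' b \<longleftrightarrow> a = b" for a b
    using assms by (auto simp: bij_def inj_eq)
  have dist: "F y \<noteq> F' y" using meet[of "F y"] y inj by metis
  have "F (F' z) = three_cycle y (F y) (F' y) (F' (F z))" for z
  proof -
    have "F (F' y) = F' y" "F' (F y) = F y"
      using meet y inj by metis+
    then show ?thesis
      using meet[of z] meet[of "F z"] meet[of "F' z"] y dist inj
      by (smt (verit) three_cycle_apply)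
  qed
  then have "F \<circ> F' = three_cycle y (F y) (F' y) \<circ> (F' \<circ> F)"
    by (auto simp: fun_eq_iff)
  then have "F \<circ> F' \<circ> inv' F \<circ> inv' F' = three_cycle y (F y) (F' y) \<circ> (F' \<circ> (F \<circ> inv' F) \<circ> inv' F')"
    by (simp add: comp_assoc)
  then show ?thesis
    using assms by (simp add: surj_iff[THEN iffD1] bij_is_surj)
qed

context perm_group
begin

lemma conj_mem: "u \<in> K \<Longrightarrow> v \<in> K \<Longrightarrow> u \<circ> v \<circ> inv' u \<in> K"
  by (simp add: comp_mem inv_mem)

definition linked :: "'a \<Rightarrow> 'a \<Rightarrow> bool" where
  "linked x y \<longleftrightarrow> x = y \<or> (\<exists>z. x \<noteq> y \<and> y \<noteq> z \<and> x \<noteq> z \<and> three_cycle x y z \<in> K)"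

lemma linked_refl: "linked x x"
  by (simp add: linked_def)

lemma linked_sym:
  assumes "linked x y" shows "linked y x"
  using assms inv_mem unfolding linked_def by (metis inv_three_cycle three_cycle_rotate)

text \<open>
  If \<open>x\<close> is not on the three-cycle through \<open>y\<close> and \<open>z\<close>, then conjugation by that cycle fixes \<open>x\<close> and
  takes \<open>y\<close> to \<open>z\<close>, so it turns a three-cycle through \<open>x\<close> and \<open>y\<close> into one through \<open>x\<close> and \<open>z\<close>. In
  the remaining cases one of the two given three-cycles already contains \<open>x\<close> and \<open>z\<close>.
\<close>

lemma linked_trans:
  assumes "linked x y" "linked y z"
  shows "linked x z"
proof (cases "x = y \<or> y = z \<or> x = z")
  case True
  then show ?thesis using assms by (auto simp: linked_refl)
next
  case False
  then obtain u v where u: "y \<noteq> u" "x \<noteq> u" "three_cycle x y u \<in> K"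
    and v: "z \<noteq> v" "y \<noteq> v" "three_cycle y z v \<in> K"
    using assms unfolding linked_def by blast
  consider "u = z" | "v = x" | "u \<noteq> z" "v \<noteq> x" by blast
  then show ?thesis
  proof cases
    case 1
    then have "three_cycle z x y \<in> K" using u False by (metis three_cycle_rotate)
    then have "linked z x" using False unfolding linked_def by blast
    then show ?thesis by (rule linked_sym)
  next
    case 2
    then have "three_cycle z x y \<in> K" using v False by (metis three_cycle_rotate)
    then have "linked z x" using False unfolding linked_def by blast
    then show ?thesis by (rule linked_sym)
  next
    case 3
    let ?c = "three_cycle y z v"
    have "three_cycle (?c x) (?c y) (?c u) \<in> K"
      using conj_mem[OF v(3) u(3)] by (simp add: conj_three_cycle bij_three_cycle)
    moreover have "?c x = x" "?c y = z" "?c u \<noteq> x" "?c u \<noteq> z"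
      using 3 u v False by (auto simp: three_cycle_apply)
    ultimately show ?thesis using False unfolding linked_def by metis
  qed
qed

lemma linked_image:
  assumes "u \<in> K" "linked x y"
  shows "linked (u x) (u y)"
proof (cases "x = y")
  case False
  then obtain z where "y \<noteq> z" "x \<noteq> z" "three_cycle x y z \<in> K"
    using assms unfolding linked_def by blast
  moreover have "inj u" using assms(1) bij_mem bij_is_inj by blast
  moreover have "three_cycle (u x) (u y) (u z) \<in> K"
    using conj_mem[OF assms(1) \<open>three_cycle x y z \<in> K\<close>] bij_mem[OF assms(1)]
    by (simp add: conj_three_cycle)
  ultimately show ?thesis using False unfolding linked_def by (metis inj_eq)
qed (simp add: linked_refl)

text \<open>
  Some three-cycle \<open>a \<mapsto> b \<mapsto> u \<mapsto> a\<close> is in \<open>K\<close>, and its last point is moved to \<open>c\<close> by conjugation with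
  a three-cycle through \<open>u\<close> and \<open>c\<close>. If the third point \<open>w\<close> of the latter is \<open>a\<close> or \<open>b\<close>, conjugation with its
  inverse gives the same three points in the opposite orientation instead.
\<close>

lemma three_cycle_mem_if_linked:
  assumes all: "\<And>x y. linked x y" and ne: "a \<noteq> b" "b \<noteq> c" "a \<noteq> c"
  shows "three_cycle a b c \<in> K"
proof -
  obtain u where u: "b \<noteq> u" "a \<noteq> u" "three_cycle a b u \<in> K"
    using all[of a b] ne unfolding linked_def by blast
  show ?thesis
  proof (cases "u = c")
    case False
    then obtain w where w: "c \<noteq> w" "u \<noteq> w" "three_cycle u c w \<in> K"
      using all[of u c] unfolding linked_def by blast
    let ?c = "three_cycle u c w" and ?d = "three_cycle w c u"
    have d: "?d \<in> K" using inv_mem[OF w(3)] by (simp add: inv_three_cycle)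
    have conj: "three_cycle (p a) (p b) (p u) \<in> K" if "p \<in> K" for p
      using conj_mem[OF that u(3)] bij_mem[OF that] by (simp add: conj_three_cycle)
    consider "w = a" | "w = b" | "w \<noteq> a" "w \<noteq> b" by blast
    then show ?thesis
    proof cases
      case 1
      then have "three_cycle c b a \<in> K"
        using conj[OF d] u w ne False by (simp add: three_cycle_apply)
      then show ?thesis using inv_mem by (metis inv_three_cycle)
    next
      case 2
      then have "three_cycle a c b \<in> K"
        using conj[OF d] u w ne False by (simp add: three_cycle_apply)
      then have "three_cycle b c a \<in> K" using inv_mem by (metis inv_three_cycle)
      then show ?thesis using ne by (metis three_cycle_rotate)
    next
      case 3
      then show ?thesis
        using conj[OF w(3)] u w ne False by (simp add: three_cycle_apply)
    qed
  qed (use u in simp)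
qed

text \<open>
  An even permutation is a product of pairs of transpositions; a pair with disjoint supports is a
  product of two three-cycles, by inserting a transposition twice between them.
\<close>

lemma even_permutation_mem:
  assumes all: "\<And>x y. linked x y" and "permutation p" "evenperm p"
  shows "p \<in> K"
proof -
  have adjacent: "transpose a b \<circ> transpose b c \<in> K" if "a \<noteq> b" "b \<noteq> c" for a b c
  proof (cases "a = c")
    case True
    then show ?thesis by (simp add: transpose_commute[of b] id_mem)
  next
    case False
    then show ?thesis
      using three_cycle_mem_if_linked[OF all that] by (simp add: three_cycle_def)
  qed
  have pair: "transpose a b \<circ> transpose c d \<in> K" if "a \<noteq> b" "c \<noteq> d" for a b c d
  proof (cases "b = c")
    case False
    have "transpose a b \<circ> transpose c d =
        (transpose a b \<circ> transpose b c) \<circ> (transpose b c \<circ> transpose c d)"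
      by (simp add: fun_eq_iff)
    then show ?thesis
      using adjacent[of a b c] adjacent[of b c d] that False comp_mem by metis
  qed (use that adjacent in blast)
  have "swapidseq n p \<Longrightarrow> even n \<Longrightarrow> p \<in> K" for n p
  proof (induction n arbitrary: p rule: less_induct)
    case (less n)
    show ?case
      using less.prems(1)
    proof (cases rule: swapidseq.cases)
      case id
      then show ?thesis using id_mem by metis
    next
      case (comp_Suc n' q a b)
      note outer = comp_Suc
      from \<open>swapidseq n' q\<close> show ?thesis
      proof (cases rule: swapidseq.cases)
        case id
        then show ?thesis using outer less.prems by simp
      next
        case (comp_Suc n'' r c d)
        then have "r \<in> K" using less.IH[of n'' r] less.prems outer by simp
        then show ?thesis
          using pair[of a b c d] comp_mem outer comp_Suc by (metis comp_assoc)
      qed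
    qed
  qed
  then show ?thesis
    using assms(2,3) by (metis evenperm_unique permutation_def)
qed

end

section \<open>Cycles of consecutive integers\<close>

definition block_cycle :: "int \<Rightarrow> nat \<Rightarrow> int \<Rightarrow> int" where
  "block_cycle a n z =
     (if a \<le> z \<and> z < a + int n then z + 1 else if z = a + int n then a else z)"

lemma swapidseq_block_cycle: "swapidseq n (block_cycle a n)"
proof (induction n)
  case 0
  have "block_cycle a 0 = id" by (rule ext) (simp add: block_cycle_def)
  then show ?case by (metis swapidseq.id)
next
  case (Suc n)
  have "block_cycle a (Suc n) = transpose a (a + int (Suc n)) \<circ> block_cycle a n"
    by (auto simp: block_cycle_def fun_eq_iff transpose_def)
  then show ?case
    using swapidseq.comp_Suc[OF Suc, of a "a + int (Suc n)"] by (metis add_cancel_right_right of_nat_0_eq_iff nat.distinct(1))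
qed

lemma even_two_block_cycles:
  "permutation (block_cycle a n \<circ> block_cycle b n)"
  "evenperm (block_cycle a n \<circ> block_cycle b n)"
proof -
  have "swapidseq (n + n) (block_cycle a n \<circ> block_cycle b n)"
    by (intro swapidseq_comp_add swapidseq_block_cycle)
  then show "permutation (block_cycle a n \<circ> block_cycle b n)"
    "evenperm (block_cycle a n \<circ> block_cycle b n)"
    using evenperm_unique[of "n + n"] by (auto simp: permutation_def)
qed

section \<open>Linking all integers\<close>

lemma perm_group_shift_multiple:
  fixes c s :: int
  assumes "perm_group K" and shift: "(\<lambda>z. z + c) \<in> K"
  shows "(\<lambda>z. z + c * s) \<in> K"
proof -
  interpret perm_group K by fact
  have pos: "(\<lambda>z. z + c * int n) \<in> K" for n
  proof (induction n)
    case 0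
    then show ?case using id_mem by (simp add: id_def)
  next
    case (Suc n)
    have "(\<lambda>z. z + c * int (Suc n)) = (\<lambda>z. z + c) \<circ> (\<lambda>z. z + c * int n)"
      by (auto simp: fun_eq_iff algebra_simps)
    then show ?case using comp_mem[OF shift Suc] by simp
  qed
  show ?thesis
  proof (cases "s \<ge> 0")
    case True
    then show ?thesis using pos[of "nat s"] by simp
  next
    case False
    have "inv' (\<lambda>z. z + c * int (nat (- s))) = (\<lambda>z. z + c * s)"
      using False by (intro inv_unique_comp) (auto simp: fun_eq_iff algebra_simps)
    then show ?thesis using inv_mem[OF pos[of "nat (- s)"]] by simp
  qed
qed

text \<open>
  The intended \<open>\<alpha>\<close> rotates \<open>{A..A + k}\<close> and \<open>{B..B + k}\<close>. That it sends \<open>B + k\<close> to \<open>B\<close> makes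
  the finitary element \<open>f\<close> of the proof send the least point of its support to the point \<open>k\<close> further right, whence the link between
  points at distance exactly \<open>k\<close> rather than some larger multiple.
\<close>

lemma all_linked_of_eventual_shift:
  fixes K :: "(int \<Rightarrow> int) set" and A B d k :: int
  assumes K: "perm_group K" and shift: "(\<lambda>z. z + k) \<in> K" and conj: "inv' \<alpha> \<circ> g \<circ> \<alpha> \<in> K"
    and pos: "k \<ge> 1" "d \<ge> 1" and dvd: "k dvd A" "k dvd B"
    and bij: "bij \<alpha>"
    and fixed: "\<And>z. z < B \<or> A + k < z \<Longrightarrow> \<alpha> z = z"
    and wrap: "\<alpha> (B + k) = B" "\<alpha> (A + k) = A"
    and step: "\<And>z. A \<le> z \<Longrightarrow> z < A + k \<Longrightarrow> \<alpha> z = z + 1"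
    and far: "\<And>z. z \<le> B \<or> A \<le> z \<Longrightarrow> g z = z + k * d"
  shows "perm_group.linked K x y"
proof -
  interpret perm_group K by fact
  note shifts = perm_group_shift_multiple[OF K shift]
  define c where "c = k * d"
  have kd: "c \<ge> k" using pos by (simp add: c_def)
  note far = far[folded c_def]
  have inv_eq: "inv' \<alpha> w = z \<longleftrightarrow> w = \<alpha> z" for w z
    using bij by (metis bij_inv_eq_iff)
  have inv_fixed: "inv' \<alpha> z = z" if "z < B \<or> A + k < z" for z
    using fixed[OF that] by (simp add: inv_eq)
  define f where "f = (\<lambda>z. inv' \<alpha> (g (\<alpha> z)) - c)"
  have "(\<lambda>z. z + k * (- d)) \<circ> (inv' \<alpha> \<circ> g \<circ> \<alpha>) \<in> K"
    by (intro comp_mem conj shifts)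
  moreover have "(\<lambda>z. z + k * (- d)) \<circ> (inv' \<alpha> \<circ> g \<circ> \<alpha>) = f"
    by (auto simp: f_def c_def)
  ultimately have f: "f \<in> K" by simp
  \<comment> \<open>\<open>D\<close> is the diameter of the support of \<open>f\<close>: translating \<open>f\<close> by it moves the least point
      of the support onto the greatest one.\<close>
  define D where "D = A + k - B + c"
  obtain e where e: "D = k * e"
    using dvd by (metis D_def c_def dvd_add dvd_diff dvd_refl dvd_triv_left dvd_def)
  define F where "F = (\<lambda>z. f (z - D) + D)"
  have "(\<lambda>z. z + k * e) \<circ> (f \<circ> (\<lambda>z. z + k * (- e))) \<in> K"
    by (intro comp_mem f shifts)
  moreover have "(\<lambda>z. z + k * e) \<circ> (f \<circ> (\<lambda>z. z + k * (- e))) = F"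
    by (auto simp: F_def e)
  ultimately have F: "F \<in> K" by simp
  have f_fix: "f z = z" if "z < B - c \<or> A + k < z" for z
  proof -
    have "\<alpha> z = z" "inv' \<alpha> (z + c) = z + c" "g z = z + c"
      using that kd pos by (auto intro!: fixed inv_fixed far)
    then show ?thesis by (simp add: f_def)
  qed
  have f_min: "f (B - c) = B - c + k"
  proof -
    have "\<alpha> (B - c) = B - c" "g (B - c) = B"
      using fixed[of "B - c"] far[of "B - c"] kd pos by auto
    moreover have "inv' \<alpha> B = B + k" using wrap by (simp add: inv_eq)
    ultimately show ?thesis by (simp add: f_def)
  qed
  define y0 where "y0 = A + k"
  have f_max: "f y0 \<noteq> y0"
  proof
    assume "f y0 = y0"
    then have "inv' \<alpha> (g A) = y0 + c" by (simp add: f_def wrap y0_def)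
    then have "g A = y0 + c"
      using fixed[of "y0 + c"] kd pos by (simp add: inv_eq y0_def)
    then show False using far[of A] pos by (simp add: y0_def)
  qed
  have F_y0: "F y0 = y0 + k"
    using f_min by (simp add: F_def D_def y0_def algebra_simps)
  have "f \<circ> F \<circ> inv' f \<circ> inv' F = three_cycle y0 (f y0) (F y0)"
  proof (rule commutator_three_cycle)
    show "f z = z \<or> F z = z" if "z \<noteq> y0" for z
    proof (cases "z < y0")
      case True
      then have "z - D < B - c" by (simp add: D_def y0_def)
      then show ?thesis using f_fix by (simp add: F_def)
    next
      case False
      then show ?thesis using f_fix[of z] that by (simp add: y0_def)
    qed
  qed (use f F bij_mem f_max F_y0 pos in auto)
  then have cycle: "three_cycle y0 (f y0) (y0 + k) \<in> K"
    using f F F_y0 by (metis comp_mem inv_mem)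
  have "f y0 \<noteq> y0 + k"
  proof
    assume "f y0 = y0 + k"
    also have "y0 + k = f (y0 + k)" using f_fix[of "y0 + k"] pos by (simp add: y0_def)
    finally have "y0 = y0 + k" using bij_mem[OF f] by (meson bij_is_inj injD)
    then show False using pos by simp
  qed
  moreover from this have "three_cycle (y0 + k) y0 (f y0) \<in> K"
    using cycle f_max pos three_cycle_rotate[of "y0 + k" y0 "f y0"] by simp
  ultimately have "linked (y0 + k) y0"
    using f_max pos unfolding linked_def by (intro disjI2 exI[of _ "f y0"]) auto
  then have base: "linked y0 (y0 + k)" by (rule linked_sym)
  have move: "linked (a + k * s) (b + k * s)" if "linked a b" for a b s
    using linked_image[OF shifts that] .
  have ladder: "linked a (a + k * s)" if "linked a (a + k)" for a s
  proof -
    have up: "linked b (b + k * int n)" if "linked b (b + k)" for b n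
    proof (induction n)
      case (Suc n)
      have "linked (b + k * int n) (b + k * int (Suc n))"
        using move[OF that, of "int n"] by (simp add: algebra_simps)
      with Suc show ?case by (rule linked_trans)
    qed (simp add: linked_refl)
    show ?thesis
    proof (cases "s \<ge> 0")
      case True
      then show ?thesis using up[OF that, of "nat s"] by simp
    next
      case False
      then show ?thesis
        using move[OF up[OF that, of "nat (- s)"], of s] linked_sym by simp
    qed
  qed
  have residue_class: "linked 0 (int i + k * s)" if "int i < k" for i s
    using that
  proof (induction i arbitrary: s)
    case 0
    obtain q where q: "y0 = k * q" using dvd unfolding y0_def by (metis dvd_add dvd_refl dvd_def)
    have "linked 0 k" using move[OF base, of "- q"] by (simp add: q)
    then show ?case using ladder[of 0 s] by simp
  next
    case (Suc i)
    obtain q where q: "A = k * q" using dvd by (auto simp: dvd_def)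
    \<comment> \<open>The partner of \<open>?p\<close> must lie in the same class but to the right of the block, where \<open>\<alpha>\<close> is
        trivial; \<open>?p + k\<close> is still in the block for \<open>i = 0\<close>, so \<open>?p + 2 * k\<close> is taken.\<close>
    let ?p = "A + int i"
    have "linked 0 (int i + k * q)" "linked 0 (int i + k * (q + 2))"
      using Suc by auto
    then have "linked (int i + k * q) (int i + k * (q + 2))"
      by (rule linked_trans[OF linked_sym])
    then have "linked ?p (?p + 2 * k)"
      by (simp add: q algebra_simps)
    then have "linked ((inv' \<alpha> \<circ> g \<circ> \<alpha>) ?p) ((inv' \<alpha> \<circ> g \<circ> \<alpha>) (?p + 2 * k))"
      by (rule linked_image[OF conj])
    moreover have "(inv' \<alpha> \<circ> g \<circ> \<alpha>) ?p = ?p + 1 + c"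
      using step[of ?p] far[of "?p + 1"] inv_fixed[of "?p + 1 + c"] Suc.prems kd by simp
    moreover have "(inv' \<alpha> \<circ> g \<circ> \<alpha>) (?p + 2 * k) = ?p + 2 * k + c"
      using fixed[of "?p + 2 * k"] far[of "?p + 2 * k"] inv_fixed[of "?p + 2 * k + c"] pos kd
      by simp
    ultimately have "linked (?p + 1 + c) (?p + 2 * k + c)" by simp
    then have "linked (int (Suc i) + k * s) (int i + k * (s + 2))"
      using move[of "?p + 1 + c" "?p + 2 * k + c" "s - q - d"]
      by (simp add: q c_def algebra_simps)
    moreover have "linked 0 (int i + k * (s + 2))" using Suc by simp
    ultimately show ?case by (metis linked_trans linked_sym)
  qed
  have "linked 0 z" for z
    using residue_class[of "nat (z mod k)" "z div k"] pos by simp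
  then show ?thesis by (metis linked_trans linked_sym)
qed

section \<open>Even finitary permutations and shifts\<close>

lemma swapidseq_conj:
  assumes "swapidseq n p" and "bij u"
  shows "swapidseq n (u \<circ> p \<circ> inv' u)"
  using assms(1)
proof induction
  case id
  have "u \<circ> id \<circ> inv' u = id" using assms(2) by (metis bij_is_surj comp_id surj_iff)
  then show ?case by (metis swapidseq.id)
next
  case (comp_Suc n p a b)
  have "u \<circ> (transpose a b \<circ> p) \<circ> inv' u = transpose (u a) (u b) \<circ> (u \<circ> p \<circ> inv' u)"
    using assms(2) by (auto simp: fun_eq_iff transpose_def bij_def inj_eq)
  moreover have "u a \<noteq> u b" using comp_Suc.hyps assms(2) by (auto simp: bij_def inj_eq)
  ultimately show ?case using swapidseq.comp_Suc[OF comp_Suc.IH] by metis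
qed

lemma AltZ_iff: "f \<in> AltZ \<longleftrightarrow> permutation f \<and> evenperm f"
  by (auto simp: AltZ_def FSymZ_def SymZ_def permutation)

lemma AltZ_iff_swapidseq: "f \<in> AltZ \<longleftrightarrow> (\<exists>n. even n \<and> swapidseq n f)"
  unfolding AltZ_iff by (metis evenperm_unique permutation_def)

lemma AltZ_conj: "f \<in> AltZ \<Longrightarrow> bij u \<Longrightarrow> u \<circ> f \<circ> inv' u \<in> AltZ"
  unfolding AltZ_iff_swapidseq by (metis swapidseq_conj)

lemma AltZ_comp: "f \<in> AltZ \<Longrightarrow> g \<in> AltZ \<Longrightarrow> f \<circ> g \<in> AltZ"
  by (auto simp: AltZ_iff evenperm_comp permutation_compose)

lemma AltZ_inv: "f \<in> AltZ \<Longrightarrow> inv' f \<in> AltZ"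
  by (auto simp: AltZ_iff evenperm_inv permutation_inverse)

lemma SymZ_inv: "bij f \<Longrightarrow> inv\<^bsub>SymZ\<^esub> f = inv' f"
  by (rule group.inv_equality[OF group_SymZ])
    (auto simp: SymZ_def bij_imp_bij_inv surj_iff[THEN iffD1] bij_is_surj)

lemma perm_group_of_subgroup:
  assumes "subgroup H SymZ"
  shows "perm_group H"
proof
  fix u v assume u: "u \<in> H"
  show "bij u" using subgroup.mem_carrier[OF assms u] by (simp add: SymZ_def)
  then show "inv' u \<in> H"
    using subgroup.m_inv_closed[OF assms u] by (simp add: SymZ_inv)
  assume "v \<in> H"
  then show "u \<circ> v \<in> H"
    using subgroup.m_closed[OF assms _ u, of v] by (simp add: SymZ_def)
next
  show "id \<in> H"
    using subgroup.one_closed[OF assms] by (simp add: SymZ_def)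
qed

lemma conj_cancel:
  assumes "bij u"
  shows "inv' u \<circ> (u \<circ> v \<circ> inv' u) \<circ> u = v" and "u \<circ> (inv' u \<circ> w \<circ> u) \<circ> inv' u = w"
  using assms by (simp_all add: fun_eq_iff bij_is_inj bij_is_surj surj_f_inv_f inv_f_f)

lemma perm_group_conj:
  assumes "perm_group H" "bij u"
  shows "perm_group {v. u \<circ> v \<circ> inv' u \<in> H}"
proof -
  interpret perm_group H by fact
  have uu: "u \<circ> inv' u = id" "inv' u \<circ> u = id"
    using assms(2) by (auto simp: bij_def surj_iff inj_iff)
  show ?thesis
  proof
    fix v w assume v: "v \<in> {v. u \<circ> v \<circ> inv' u \<in> H}"
    then have "bij (u \<circ> v \<circ> inv' u)" using bij_mem by simp
    then have "bij (inv' u \<circ> (u \<circ> v \<circ> inv' u) \<circ> u)"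
      using assms(2) by (metis bij_comp bij_imp_bij_inv)
    then show bv: "bij v" by (simp only: conj_cancel[OF assms(2)])
    have "inv' (u \<circ> v \<circ> inv' u) = u \<circ> inv' v \<circ> inv' u"
      using bv assms(2) by (simp add: o_inv_distrib bij_comp bij_imp_bij_inv inv_inv_eq comp_assoc)
    then show "inv' v \<in> {v. u \<circ> v \<circ> inv' u \<in> H}" using v inv_mem by fastforce
    assume w: "w \<in> {v. u \<circ> v \<circ> inv' u \<in> H}"
    have "(u \<circ> v \<circ> inv' u) \<circ> (u \<circ> w \<circ> inv' u) = u \<circ> v \<circ> (inv' u \<circ> u) \<circ> w \<circ> inv' u"
      by (simp only: comp_assoc)
    also have "\<dots> = u \<circ> (v \<circ> w) \<circ> inv' u"
      by (simp only: uu comp_id) (simp only: comp_assoc)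
    finally have "(u \<circ> v \<circ> inv' u) \<circ> (u \<circ> w \<circ> inv' u) = u \<circ> (v \<circ> w) \<circ> inv' u" .
    then show "v \<circ> w \<in> {v. u \<circ> v \<circ> inv' u \<in> H}"
      using comp_mem v w by fastforce
  qed (simp add: id_mem uu)
qed

text \<open>
  In a product, translations are moved past even permutations by conjugation. Translations are not
  finitary, so this rests on parity being invariant under conjugation by arbitrary bijections.
\<close>

lemma Gk_eq_Alt_times_shift:
  assumes "g \<in> Gk k"
  obtains \<sigma> m where "\<sigma> \<in> AltZ" "g = (\<lambda>z. \<sigma> z + int k * m)"
proof -
  have "\<exists>\<sigma> m. \<sigma> \<in> AltZ \<and> g = (\<lambda>z. \<sigma> z + int k * m)"
    using assms unfolding Gk_def
  proof (induction rule: generate.induct)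
    case one
    have "id \<in> AltZ" by (simp add: AltZ_iff permutation_id)
    moreover have "\<one>\<^bsub>SymZ\<^esub> = (\<lambda>z. id z + int k * 0)" by (auto simp: SymZ_def)
    ultimately show ?case by blast
  next
    case (incl h)
    show ?case
    proof (cases "h \<in> AltZ")
      case True
      then show ?thesis by (intro exI[of _ h] exI[of _ 0]) auto
    next
      case False
      then have "h = (\<lambda>z. z + int k)" using incl by (simp add: transl_pow)
      then show ?thesis
        by (intro exI[of _ id] exI[of _ 1]) (auto simp: AltZ_iff permutation_id)
    qed
  next
    case (inv h)
    show ?case
    proof (cases "h \<in> AltZ")
      case True
      then have "bij h" by (simp add: AltZ_iff permutation)
      with True show ?thesis
        by (intro exI[of _ "inv' h"] exI[of _ 0]) (auto simp: SymZ_inv AltZ_inv)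
    next
      case False
      then have h: "h = (\<lambda>z. z + int k)" using inv by (simp add: transl_pow)
      then have "bij h"
        by (intro o_bij[of "\<lambda>z. z - int k"]) auto
      moreover have "inv' h = (\<lambda>z. z - int k)"
        unfolding h by (intro inv_unique_comp) auto
      ultimately show ?thesis
        by (intro exI[of _ id] exI[of _ "- 1"]) (auto simp: AltZ_iff permutation_id SymZ_inv)
    qed
  next
    case (eng h1 h2)
    then obtain \<sigma>1 m1 \<sigma>2 m2 where h1: "\<sigma>1 \<in> AltZ" "h1 = (\<lambda>z. \<sigma>1 z + int k * m1)"
      and h2: "\<sigma>2 \<in> AltZ" "h2 = (\<lambda>z. \<sigma>2 z + int k * m2)" by blast
    define u where "u = (\<lambda>z. z - int k * m1)"
    have "bij u"
      by (intro o_bij[of "\<lambda>z. z + int k * m1"]) (auto simp: u_def)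
    moreover have inv_u: "inv' u = (\<lambda>z. z + int k * m1)"
      unfolding u_def by (intro inv_unique_comp) auto
    ultimately have "u \<circ> \<sigma>2 \<circ> inv' u \<circ> \<sigma>1 \<in> AltZ"
      using h1(1) h2(1) AltZ_comp AltZ_conj by blast
    moreover have "h1 \<otimes>\<^bsub>SymZ\<^esub> h2 = (\<lambda>z. (u \<circ> \<sigma>2 \<circ> inv' u \<circ> \<sigma>1) z + int k * (m1 + m2))"
      unfolding inv_u by (auto simp: SymZ_def h1 h2 u_def fun_eq_iff algebra_simps)
    ultimately show ?case by blast
  qed
  then show ?thesis using that by blast
qed

text \<open>
  Passing to the inverse makes the translation positive and does not change the subgroups that \<open>g\<close>
  generates together with other elements.
\<close>

lemma eventual_shift_of_Gk:
  assumes "g \<in> Gk k - AltZ"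
  obtains N d g' where "d \<ge> 1" "g' = g \<or> g' = inv' g"
    "\<And>z. N \<le> \<bar>z\<bar> \<Longrightarrow> g' z = z + int k * d"
proof -
  obtain \<sigma> m where \<sigma>: "\<sigma> \<in> AltZ" and g: "g = (\<lambda>z. \<sigma> z + int k * m)"
    using assms Gk_eq_Alt_times_shift by blast
  have "m \<noteq> 0" using assms \<sigma> g by auto
  have bij: "bij g"
    using assms subgroup.mem_carrier[OF subgroup_Gk] by (auto simp: SymZ_def)
  have "finite {z. \<sigma> z \<noteq> z}" using \<sigma> by (simp add: AltZ_iff permutation)
  then have "bdd_above (abs ` {z. \<sigma> z \<noteq> z})" by simp
  then obtain M where M: "\<And>z. \<sigma> z \<noteq> z \<Longrightarrow> \<bar>z\<bar> \<le> M"
    by (auto simp: bdd_above_def)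
  then have far: "g z = z + int k * m" if "M < \<bar>z\<bar>" for z
    using that by (force simp: g)
  show ?thesis
  proof (cases "m > 0")
    case True
    then show ?thesis using that[of m g "M + 1"] far by auto
  next
    case False
    have "inv' g z = z + int k * (- m)" if "M + 1 + \<bar>int k * m\<bar> \<le> \<bar>z\<bar>" for z
    proof -
      have "g (z - int k * m) = z" using far[of "z - int k * m"] that by auto
      then have "inv' g z = z - int k * m" using bij by (metis bij_inv_eq_iff)
      then show ?thesis by simp
    qed
    then show ?thesis using that[of "- m" "inv' g"] False \<open>m \<noteq> 0\<close> by auto
  qed
qed

section \<open>Generation by a common conjugate of the translation\<close>

theorem theorem4p4:
  fixes k n :: nat and g :: "nat \<Rightarrow> int \<Rightarrow> int"
  assumes "k \<ge> 1" and "n \<ge> 1"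
    and "\<And>i. i \<in> {1..n} \<Longrightarrow> g i \<in> Gk k - AltZ"
  shows "\<exists>h \<in> conjugacy_class (SymZ\<lparr>carrier := Gk k\<rparr>) (transl [^]\<^bsub>SymZ\<^esub> k).
           \<forall>i \<in> {1..n}. generate SymZ {g i, h} = Gk k"
proof -
  interpret S: group SymZ by (rule group_SymZ)
  interpret Gk: perm_group "Gk k" by (rule perm_group_of_subgroup[OF subgroup_Gk])
  define t where "t = (\<lambda>z. z + int k)"
  have t_pow: "transl [^]\<^bsub>SymZ\<^esub> k = t" by (simp add: t_def transl_pow)
  have t_Gk: "t \<in> Gk k"
    unfolding Gk_def t_pow by (rule generate.incl) simp
  have Alt_Gk: "AltZ \<subseteq> Gk k"
    unfolding Gk_def by (auto intro: generate.incl)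
  define shifts_beyond where "shifts_beyond i N \<longleftrightarrow> (\<exists>d g'. d \<ge> 1 \<and>
    (g' = g i \<or> g' = inv' (g i)) \<and> (\<forall>z. N \<le> \<bar>z\<bar> \<longrightarrow> g' z = z + int k * d))" for i N
  have "\<forall>i\<in>{1..n}. \<exists>N. shifts_beyond i N"
  proof
    fix i assume "i \<in> {1..n}"
    from eventual_shift_of_Gk[OF assms(3)[OF this]] obtain N d g'
      where "d \<ge> 1" "g' = g i \<or> g' = inv' (g i)" "\<And>z. N \<le> \<bar>z\<bar> \<Longrightarrow> g' z = z + int k * d"
      by (metis (no_types))
    then show "\<exists>N. shifts_beyond i N" unfolding shifts_beyond_def by metis
  qed
  then obtain N where N: "\<And>i. i \<in> {1..n} \<Longrightarrow> shifts_beyond i (N i)"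
    using bchoice by metis
  \<comment> \<open>The element 1 is included so that \<open>T\<close> is positive and \<open>k * T \<ge> T\<close>.\<close>
  define T where "T = Max (insert 1 (N ` {1..n}))"
  have T: "T \<ge> 1" "i \<in> {1..n} \<Longrightarrow> N i \<le> T" for i
    unfolding T_def by (intro Max_ge; simp)+
  define A where "A = int k * T"
  \<comment> \<open>The left block then ends at \<open>- A - k\<close>, so that \<open>B\<close> is below \<open>- T\<close> and the blocks are disjoint.\<close>
  define B where "B = - A - 2 * int k"
  have A: "A \<ge> T" "int k dvd A" using T(1) assms(1) by (simp_all add: A_def)
  then have B: "int k dvd B" by (simp add: B_def)
  define \<alpha> where "\<alpha> = block_cycle A k \<circ> block_cycle B k"
  have \<alpha>: "\<alpha> \<in> AltZ" and bij: "bij \<alpha>"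
    using even_two_block_cycles by (auto simp: \<alpha>_def AltZ_iff permutation)
  then have inv_\<alpha>: "inv' \<alpha> \<circ> \<alpha> = id" "\<alpha> \<circ> inv' \<alpha> = id"
    by (auto simp: bij_def surj_iff inj_iff)
  define h where "h = \<alpha> \<circ> t \<circ> inv' \<alpha>"
  have h_Gk: "h \<in> Gk k" unfolding h_def using Gk.conj_mem \<alpha> Alt_Gk t_Gk by blast
  have "generate SymZ {g i, h} = Gk k" if i: "i \<in> {1..n}" for i
  proof -
    define H where "H = generate SymZ {g i, h}"
    have gens: "{g i, h} \<subseteq> Gk k" using assms(3)[OF i] h_Gk by blast
    have sub: "subgroup H SymZ"
      unfolding H_def using gens subgroup.subset[OF subgroup_Gk]
      by (intro S.generate_is_subgroup) blast
    interpret H: perm_group H by (rule perm_group_of_subgroup[OF sub])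
    have g_H: "g i \<in> H" and h_H: "h \<in> H"
      by (auto simp: H_def intro: generate.incl)
    \<comment> \<open>In \<open>K\<close> the mate becomes the translation and \<open>g i\<close> is conjugated instead. Once \<open>AltZ\<close> is inside
        \<open>K\<close>, so is \<open>\<alpha>\<close>, and then \<open>K\<close> and \<open>H\<close> coincide.\<close>
    define K where "K = {v. \<alpha> \<circ> v \<circ> inv' \<alpha> \<in> H}"
    have K: "perm_group K"
      unfolding K_def by (intro perm_group_conj bij H.perm_group_axioms)
    interpret K: perm_group K by (rule K)
    obtain d g' where d: "d \<ge> 1" and g': "g' = g i \<or> g' = inv' (g i)"
      and far: "\<And>z. N i \<le> \<bar>z\<bar> \<Longrightarrow> g' z = z + int k * d"
      using N[OF i] unfolding shifts_beyond_def by metis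
    have "\<alpha> \<circ> (inv' \<alpha> \<circ> g' \<circ> \<alpha>) \<circ> inv' \<alpha> = g'"
      by (rule conj_cancel(2)[OF bij])
    then have conj_K: "inv' \<alpha> \<circ> g' \<circ> \<alpha> \<in> K"
      using g' g_H H.inv_mem by (auto simp: K_def)
    have t_K: "(\<lambda>z. z + int k) \<in> K"
      using h_H by (simp add: K_def h_def t_def)
    have linked: "K.linked x y" for x y
    proof (rule all_linked_of_eventual_shift[where B = B and A = A and g = g', OF K t_K conj_K])
      show "g' z = z + int k * d" if "z \<le> B \<or> A \<le> z" for z
        using that far[of z] T(1) T(2)[OF i] A(1) unfolding B_def by linarith
    qed (use assms(1) d bij A B T(1) in \<open>auto simp: \<alpha>_def block_cycle_def B_def\<close>)
    have Alt_K: "AltZ \<subseteq> K"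
      using K.even_permutation_mem[OF linked] by (auto simp: AltZ_iff)
    have "\<alpha> \<circ> \<alpha> \<circ> inv' \<alpha> = \<alpha>" by (simp add: comp_assoc inv_\<alpha>)
    then have \<alpha>_H: "\<alpha> \<in> H" using Alt_K \<alpha> by (auto simp: K_def)
    have K_H: "v \<in> H" if "v \<in> K" for v
    proof -
      have "inv' \<alpha> \<circ> (\<alpha> \<circ> v \<circ> inv' \<alpha>) \<circ> \<alpha> \<in> H"
        using that \<alpha>_H H.comp_mem H.inv_mem by (auto simp: K_def)
      moreover have "inv' \<alpha> \<circ> (\<alpha> \<circ> v \<circ> inv' \<alpha>) \<circ> \<alpha> = v"
        by (rule conj_cancel(1)[OF bij])
      ultimately show ?thesis by simp
    qed
    have "Gk k \<subseteq> H"
      unfolding Gk_def t_pow using Alt_K K_H t_K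
      by (intro S.generate_subgroup_incl[OF _ sub]) (auto simp: t_def)
    moreover have "H \<subseteq> Gk k"
      unfolding H_def by (rule S.generate_subgroup_incl[OF gens subgroup_Gk])
    ultimately show ?thesis by (simp add: H_def)
  qed
  moreover have "h \<in> conjugacy_class (SymZ\<lparr>carrier := Gk k\<rparr>) (transl [^]\<^bsub>SymZ\<^esub> k)"
  proof -
    have "inv\<^bsub>SymZ\<lparr>carrier := Gk k\<rparr>\<^esub> \<alpha> = inv' \<alpha>"
      using S.m_inv_consistent[OF subgroup_Gk] \<alpha> Alt_Gk bij by (auto simp: SymZ_inv)
    then show ?thesis
      unfolding conjugacy_class_def t_pow using \<alpha> Alt_Gk
      by (auto simp: h_def SymZ_def comp_assoc intro!: exI[of _ \<alpha>])
  qed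
  ultimately show ?thesis by blast
qed

end
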